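(* Let $G$ be a locally compact abelian Hausdorff group, $H$ a closed subgroup of $G$, $\varGamma$ the dual group of $G$, and $\varLambda\subseteq\varGamma$ the annihilator of $H$. Let $\mu$ be a regular finite non-negative Borel measure on $\varGamma$ and let $\alpha\in(0,\infty)$. Assume that $\varLambda$ is metrizable. If $\mu$ is concentrated on a transversal, then the space $\mathbf{P}(H)$ of trigonometric $H$-polynomials is dense in $L^\alpha(\mu)$.
   Context: All groups are written additively; $\langle\gamma,x\rangle$ denotes the value of the character $\gamma\in\varGamma$ at $x\in G$. The annihilator of $H$ is $\varLambda:=\{\gamma\in\varGamma:\langle\gamma,y\rangle=1 \text{ for all } y\in H\}$, a closed subgroup of $\varGamma$. A trigonometric $H$-polynomial is a function $p:\varGamma\to\mathbb{C}$ that is a finite sum $p(\cdot)=\sum_k a_k\langle\cdot,y_k\rangle$ with $a_k\in\mathbb{C}$, $y_k\in H$; $\mathbf{P}(H)$ is the linear space of all of them. A finite non-negative Borel measure $\mu$ on a Hausdorff space $X$ is regular if for every Borel set $B$ and every $\varepsilon>0$ there are a compact set $C$ and an open set $U$ with $C\subseteq B\subseteq U$ and $\mu(U\setminus C)<\varepsilon$. For $\alpha\in(0,\infty)$, $L^\alpha(\mu)$ is the metric space of ($\mu$-equivalence classes of) Borel measurable functions $f:\varGamma\to\mathbb{C}$ with $\int_\varGamma|f|^\alpha\,d\mu<\infty$, where convergence $f_n\to f$ means $\int_\varGamma|f_n-f|^\alpha\,d\mu\to0$. The measure $\mu$ is said to be concentrated on a transversal if there exists a Borel set $D\subseteq\varGamma$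 such that $\mu(\varGamma\setminus D)=0$ and $D\cap(\lambda+D)=\emptyset$ for all $\lambda\in\varLambda\setminus\{0\}$. *)

theory Defs
  imports "HOL-Analysis.Analysis"
begin

section \<open>The dual group\<close>

typedef (overloaded) ('g :: topological_ab_group_add) dual =
  "{\<phi> :: 'g \<Rightarrow> complex. continuous_on UNIV \<phi> \<and> (\<forall>x. norm (\<phi> x) = 1) \<and>
      (\<forall>x y. \<phi> (x + y) = \<phi> x * \<phi> y)}"
  morphisms pairing Abs_dual
  by (intro exI[of _ "\<lambda>_. 1"]) auto

setup_lifting type_definition_dual

text \<open>The value of the character \<open>\<gamma>\<close> at the group element \<open>x\<close> is \<open>pairing \<gamma> x\<close>.\<close>

lemma continuous_on_pairing: "continuous_on UNIV (pairing \<gamma>)"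
  by transfer simp

lemma norm_pairing [simp]: "norm (pairing \<gamma> x) = 1"
  by transfer simp

lemma pairing_add_right: "pairing \<gamma> (x + y) = pairing \<gamma> x * pairing \<gamma> y"
  by transfer simp

lemma dual_eqI: "(\<And>x. pairing \<gamma> x = pairing \<delta> x) \<Longrightarrow> \<gamma> = \<delta>"
  by transfer auto

text \<open>The group operation is pointwise multiplication of characters, written additively.\<close>

instantiation dual :: (topological_ab_group_add) ab_group_add
begin

lift_definition zero_dual :: "'a dual" is "\<lambda>_. 1"
  by simp

lift_definition plus_dual :: "'a dual \<Rightarrow> 'a dual \<Rightarrow> 'a dual" is "\<lambda>\<phi> \<psi> x. \<phi> x * \<psi> x"
  by (auto intro!: continuous_intros simp: norm_mult)

lift_definition uminus_dual :: "'a dual \<Rightarrow> 'a dual" is "\<lambda>\<phi> x. inverse (\<phi> x)"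
proof -
  fix \<phi> :: "'a \<Rightarrow> complex"
  assume *: "continuous_on UNIV \<phi> \<and> (\<forall>x. norm (\<phi> x) = 1) \<and> (\<forall>x y. \<phi> (x + y) = \<phi> x * \<phi> y)"
  then have "\<forall>x. \<phi> x \<noteq> 0"
    by (metis norm_zero zero_neq_one)
  with * show "continuous_on UNIV (\<lambda>x. inverse (\<phi> x)) \<and> (\<forall>x. norm (inverse (\<phi> x)) = 1) \<and>
      (\<forall>x y. inverse (\<phi> (x + y)) = inverse (\<phi> x) * inverse (\<phi> y))"
    by (auto intro!: continuous_on_inverse simp: norm_inverse)
qed

definition minus_dual :: "'a dual \<Rightarrow> 'a dual \<Rightarrow> 'a dual" where
  "minus_dual \<gamma> \<delta> = \<gamma> + - \<delta>"

instance
proof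
  fix a b c :: "'a dual"
  show "a + b + c = a + (b + c)" by transfer (simp add: mult.assoc)
  show "a + b = b + a" by transfer (simp add: mult.commute)
  show "0 + a = a" by transfer simp
  show "- a + a = 0"
  proof (transfer, rule ext)
    fix \<phi> :: "'a \<Rightarrow> complex" and x
    assume "continuous_on UNIV \<phi> \<and> (\<forall>x. norm (\<phi> x) = 1) \<and> (\<forall>x y. \<phi> (x + y) = \<phi> x * \<phi> y)"
    then have "\<phi> x \<noteq> 0"
      by (metis norm_zero zero_neq_one)
    then show "inverse (\<phi> x) * \<phi> x = 1" by simp
  qed
  show "a - b = a + - b" by (simp add: minus_dual_def)
qed

end

lemma pairing_zero [simp]: "pairing 0 x = 1"
  by transfer simp

lemma pairing_add: "pairing (\<gamma> + \<delta>) x = pairing \<gamma> x * pairing \<delta> x"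
  by transfer simp

lemma pairing_uminus: "pairing (- \<gamma>) x = inverse (pairing \<gamma> x)"
  by transfer simp

text \<open>The dual group carries the compact-open topology.\<close>

instantiation dual :: (topological_ab_group_add) topological_space
begin

definition open_dual :: "'a dual set \<Rightarrow> bool" where
  "open_dual = generate_topology {{\<gamma>. pairing \<gamma> ` K \<subseteq> V} | K V. compact K \<and> open V}"

instance
  by standard (auto simp: open_dual_def intro: generate_topology.intros)

end

lemma open_dual_subbasic:
  fixes K :: "'g :: topological_ab_group_add set"
  assumes "compact K" "open V"
  shows "open {\<gamma>. pairing \<gamma> ` K \<subseteq> V}"
  unfolding open_dual_def using assms by (blast intro: generate_topology.Basis)

lemma continuous_on_pairing_left: "continuous_on UNIV (\<lambda>\<gamma>. pairing \<gamma> x)"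
proof (rule continuous_on_open_vimage[OF open_UNIV, THEN iffD2], intro allI impI)
  fix V :: "complex set" assume "open V"
  moreover have "(\<lambda>\<gamma>. pairing \<gamma> x) -` V = {\<gamma>. pairing \<gamma> ` {x} \<subseteq> V}" by auto
  ultimately show "open ((\<lambda>\<gamma>. pairing \<gamma> x) -` V \<inter> UNIV)"
    using open_dual_subbasic[of "{x}" V] by simp
qed

instance dual :: (topological_ab_group_add) t2_space
proof
  fix \<gamma> \<delta> :: "'a dual"
  assume "\<gamma> \<noteq> \<delta>"
  then have "\<exists>x. pairing \<gamma> x \<noteq> pairing \<delta> x"
    by (rule contrapos_np) (simp add: dual_eqI)
  then obtain x where x: "pairing \<gamma> x \<noteq> pairing \<delta> x" ..
  from hausdorff[OF x] obtain U V
    where "open U" "open V" "pairing \<gamma> x \<in> U" "pairing \<delta> x \<in> V" "U \<inter> V = {}"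
    by auto
  moreover have "open ((\<lambda>\<gamma>. pairing \<gamma> x) -` W)" if "open W" for W
    using that continuous_on_pairing_left by (rule open_vimage)
  ultimately show "\<exists>U V. open U \<and> open V \<and> \<gamma> \<in> U \<and> \<delta> \<in> V \<and> U \<inter> V = {}"
    by (intro exI[of _ "(\<lambda>\<gamma>. pairing \<gamma> x) -` U"] exI[of _ "(\<lambda>\<gamma>. pairing \<gamma> x) -` V"]) auto
qed


text \<open>Convergence in the compact-open topology is uniform convergence on compact sets.\<close>

lemma tendsto_dual_iff:
  fixes f :: "'b \<Rightarrow> 'g :: topological_ab_group_add dual"
  shows "(f \<longlongrightarrow> \<gamma>) F \<longleftrightarrow>
    (\<forall>K. compact K \<longrightarrow> uniform_limit K (\<lambda>n. pairing (f n)) (pairing \<gamma>) F)"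
proof (intro iffI allI impI)
  fix K :: "'g set"
  assume lim: "(f \<longlongrightarrow> \<gamma>) F" and K: "compact K"
  show "uniform_limit K (\<lambda>n. pairing (f n)) (pairing \<gamma>) F"
  proof (rule uniform_limitI)
    fix e :: real assume e: "e > 0"
    have "compact (pairing \<gamma> ` K)"
      
      by (rule compact_continuous_image[OF continuous_on_subset[OF continuous_on_pairing] K]) simp
    then obtain C where C: "finite C" "pairing \<gamma> ` K \<subseteq> (\<Union>c\<in>C. ball c (e/3))"
    proof (rule compactE_image)
      show "open (ball c (e/3))" for c :: complex by simp
      show "pairing \<gamma> ` K \<subseteq> (\<Union>c\<in>UNIV. ball c (e/3))"
        using e by (meson UN_I UNIV_I centre_in_ball divide_pos_pos subsetI zero_less_numeral)
    qed auto
    define L where "L c = K \<inter> pairing \<gamma> -` cball c (e/3)" for c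
    have L: "compact (L c)" for c
      unfolding L_def using K continuous_on_pairing
      by (intro compact_Int_closed closed_vimage) auto
    have "eventually (\<lambda>n. pairing (f n) ` L c \<subseteq> ball c (e/2)) F" for c
    proof -
      have "\<gamma> \<in> {\<delta>. pairing \<delta> ` L c \<subseteq> ball c (e/2)}"
        using e by (auto simp: L_def)
      from topological_tendstoD[OF lim open_dual_subbasic[OF L open_ball] this]
      show ?thesis by simp
    qed
    then have "eventually (\<lambda>n. \<forall>c\<in>C. pairing (f n) ` L c \<subseteq> ball c (e/2)) F"
      using C(1) by (simp add: eventually_ball_finite)
    then show "eventually (\<lambda>n. \<forall>x\<in>K. dist (pairing (f n) x) (pairing \<gamma> x) < e) F"
    proof eventually_elim
      case (elim n)
      show ?case
      proof
        fix x assume x: "x \<in> K"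
        with C(2) obtain c where c: "c \<in> C" "dist c (pairing \<gamma> x) < e/3" by auto
        with x have "x \<in> L c" by (simp add: L_def)
        with elim c(1) have "pairing (f n) x \<in> ball c (e/2)" by blast
        then have "dist c (pairing (f n) x) < e/2" by (simp only: mem_ball)
        with c(2) e show "dist (pairing (f n) x) (pairing \<gamma> x) < e"
          using dist_triangle3[of "pairing (f n) x" "pairing \<gamma> x" c] by linarith
      qed
    qed
  qed
next
  assume *: "\<forall>K. compact K \<longrightarrow> uniform_limit K (\<lambda>n. pairing (f n)) (pairing \<gamma>) F"
  have sub: "eventually (\<lambda>n. pairing (f n) ` K \<subseteq> V) F"
    if K: "compact K" and V: "open V" and \<gamma>: "pairing \<gamma> ` K \<subseteq> V" for K V
  proof -
    have "compact (pairing \<gamma> ` K)"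
      
      by (rule compact_continuous_image[OF continuous_on_subset[OF continuous_on_pairing] K]) simp
    then obtain e where e: "e > 0" "(\<Union>z\<in>pairing \<gamma> ` K. ball z e) \<subseteq> V"
      using compact_subset_open_imp_ball_epsilon_subset[OF _ V \<gamma>] by metis
    from *[rule_format, OF K] e(1)
    have "eventually (\<lambda>n. \<forall>x\<in>K. dist (pairing (f n) x) (pairing \<gamma> x) < e) F"
      by (rule uniform_limitD)
    then show ?thesis
    proof eventually_elim
      case (elim n)
      have "pairing (f n) x \<in> V" if "x \<in> K" for x
      proof -
        have "pairing (f n) x \<in> ball (pairing \<gamma> x) e"
          using elim that by (simp add: dist_commute)
        then show ?thesis using e(2) that by blast
      qed
      then show ?case by auto
    qed
  qed
  have "eventually (\<lambda>n. f n \<in> U) F"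
    if "generate_topology {{\<gamma>. pairing \<gamma> ` K \<subseteq> V} | K V. compact K \<and> open V} U" "\<gamma> \<in> U" for U
    using that
  proof (induction rule: generate_topology.induct)
    case (UN \<U>)
    then obtain W where "W \<in> \<U>" "eventually (\<lambda>n. f n \<in> W) F" by auto
    then show ?case by (auto elim: eventually_mono)
  qed (auto intro: eventually_conj sub)
  then show "(f \<longlongrightarrow> \<gamma>) F"
    by (intro topological_tendstoI) (simp add: open_dual_def)
qed

instance dual :: (topological_ab_group_add) topological_ab_group_add
proof
  fix a b :: "'a dual"
  have a: "uniform_limit K (\<lambda>p. pairing (fst p)) (pairing a) (nhds a \<times>\<^sub>F nhds b)"
    and b: "uniform_limit K (\<lambda>p. pairing (snd p)) (pairing b) (nhds a \<times>\<^sub>F nhds b)"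
    if "compact K" for K
    using that tendsto_dual_iff[of fst a "nhds a \<times>\<^sub>F nhds b"]
      tendsto_dual_iff[of snd b "nhds a \<times>\<^sub>F nhds b"] filterlim_fst filterlim_snd by blast+
  have bdd: "bounded (pairing c ` K)" for c :: "'a dual" and K
    by (auto simp: bounded_iff intro!: exI[of _ 1])
  have "uniform_limit K (\<lambda>p. pairing (fst p + snd p)) (pairing (a + b)) (nhds a \<times>\<^sub>F nhds b)"
    if "compact K" for K
    using uniform_lim_mult[OF a b bdd bdd, OF that that] by (simp add: pairing_add[abs_def])
  then show "((\<lambda>x. fst x + snd x) \<longlongrightarrow> a + b) (nhds a \<times>\<^sub>F nhds b)"
    by (simp add: tendsto_dual_iff)
  have "uniform_limit K pairing (pairing a) (nhds a)" if "compact K" for K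
    using that tendsto_dual_iff[of "\<lambda>x. x" a "nhds a"] by (simp add: filterlim_ident)
  moreover have "dist (pairing (- x) y) (pairing (- a) y) = dist (pairing x y) (pairing a y)"
    for x y
  proof -
    have "pairing x y \<noteq> 0" "pairing a y \<noteq> 0"
      by (metis norm_pairing norm_zero zero_neq_one)+
    then have "inverse (pairing x y) - inverse (pairing a y) =
        - (inverse (pairing x y) * (pairing x y - pairing a y) * inverse (pairing a y))"
      by (rule inverse_diff_inverse)
    then show ?thesis
      by (simp add: pairing_uminus dist_norm norm_mult norm_inverse)
  qed
  ultimately show "(uminus \<longlongrightarrow> - a) (nhds a)"
    unfolding tendsto_dual_iff uniform_limit_iff by simp
qed


section \<open>Subgroups, annihilators, trigonometric polynomials\<close>

definition is_subgroup :: "'g :: ab_group_add set \<Rightarrow> bool" where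
  "is_subgroup H \<longleftrightarrow> 0 \<in> H \<and> (\<forall>x\<in>H. \<forall>y\<in>H. x + y \<in> H) \<and> (\<forall>x\<in>H. - x \<in> H)"

definition annihilator :: "'g :: topological_ab_group_add set \<Rightarrow> 'g dual set" where
  "annihilator H = {\<gamma>. \<forall>y\<in>H. pairing \<gamma> y = 1}"

definition trig_polys :: "'g :: topological_ab_group_add set \<Rightarrow> ('g dual \<Rightarrow> complex) set" where
  "trig_polys H = {p. \<exists>(n::nat) a y. (\<forall>k<n. y k \<in> H) \<and>
                        p = (\<lambda>\<gamma>. \<Sum>k<n. a k * pairing \<gamma> (y k))}"


section \<open>Measures and the spaces of power-integrable functions\<close>

definition regular_finite_borel_measure :: "'x :: t2_space measure \<Rightarrow> bool" where
  "regular_finite_borel_measure \<mu> \<longleftrightarrow>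
     sets \<mu> = sets borel \<and> finite_measure \<mu> \<and>
     (\<forall>B\<in>sets borel. \<forall>\<epsilon>>0. \<exists>C U. compact C \<and> open U \<and> C \<subseteq> B \<and> B \<subseteq> U \<and> measure \<mu> (U - C) < \<epsilon>)"

definition concentrated_on_transversal ::
    "'g :: topological_ab_group_add dual measure \<Rightarrow> 'g dual set \<Rightarrow> bool" where
  "concentrated_on_transversal \<mu> \<Lambda> \<longleftrightarrow>
     (\<exists>D\<in>sets borel. emeasure \<mu> (UNIV - D) = 0 \<and> (\<forall>\<kappa>\<in>\<Lambda> - {0}. D \<inter> (+) \<kappa> ` D = {}))"

text \<open>The elements of \<open>L\<^sup>\<alpha>(\<mu>)\<close> are represented by functions; both convergence and density
  depend only on the classes of functions modulo equality almost everywhere.\<close>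

definition L_space :: "real \<Rightarrow> 'x measure \<Rightarrow> ('x \<Rightarrow> complex) set" where
  "L_space \<alpha> \<mu> = {f \<in> borel_measurable \<mu>. (\<integral>\<^sup>+x. ennreal (norm (f x) powr \<alpha>) \<partial>\<mu>) < \<infinity>}"

definition L_converges ::
    "real \<Rightarrow> 'x measure \<Rightarrow> (nat \<Rightarrow> 'x \<Rightarrow> complex) \<Rightarrow> ('x \<Rightarrow> complex) \<Rightarrow> bool" where
  "L_converges \<alpha> \<mu> f g \<longleftrightarrow> (\<lambda>n. \<integral>\<^sup>+x. ennreal (norm (f n x - g x) powr \<alpha>) \<partial>\<mu>) \<longlonglongrightarrow> 0"

definition dense_in_L :: "real \<Rightarrow> 'x measure \<Rightarrow> ('x \<Rightarrow> complex) set \<Rightarrow> bool" where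
  "dense_in_L \<alpha> \<mu> P \<longleftrightarrow> P \<subseteq> L_space \<alpha> \<mu> \<and>
     (\<forall>f\<in>L_space \<alpha> \<mu>. \<exists>p. (\<forall>n. p n \<in> P) \<and> L_converges \<alpha> \<mu> p f)"

end

theory Submission
  imports Defs
begin

text \<open>The \<open>H\<close>-polynomials form an algebra of bounded continuous functions that contains the constants
  and is closed under conjugation. They cannot tell apart two characters whose difference annihilates
  \<open>H\<close>, but this is the only obstruction, and on a transversal \<open>D\<close> it disappears
  (\<open>transversal_separated\<close>). Hence, by the Stone-Weierstrass theorem, every continuous function on
  a compact subset of \<open>D\<close> is there a uniform limit of \<open>H\<close>-polynomials.

  Such an approximation says nothing about the size of the polynomial off the compact set. It can be
  controlled when the function to be approximated takes only the values \<open>0\<close> and \<open>1\<close>: for disjoint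
  compact sets \<open>A, C \<subseteq> D\<close>, a real \<open>H\<close>-polynomial \<open>f\<close> close to \<open>1\<close> on \<open>A\<close> and close to \<open>0\<close>
  on \<open>C\<close> is bounded, so it can be composed with an ordinary polynomial that approximates,
  on an interval containing the range of \<open>f\<close>, a truncation with values in \<open>[0, 1]\<close>. The composition is
  again an \<open>H\<close>-polynomial, and it lies between \<open>-\<delta>\<close> and \<open>1 + \<delta>\<close> everywhere
  (\<open>real_trig_polys_separate_compacts\<close>).

  Given a Borel set \<open>B\<close>, regularity provides compact sets \<open>A \<subseteq> B \<inter> D\<close> and \<open>C \<subseteq> D - B\<close> that carry
  almost all of the mass (\<open>compact_pair_exhausting\<close>). The \<open>H\<close>-polynomial belonging to \<open>A\<close> and \<open>C\<close> is
  uniformly close to the indicator of \<open>B\<close> on \<open>A \<union> C\<close> and at distance at most \<open>2\<close> from it elsewhere,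
  so indicators belong to the \<open>L\<^sup>\<alpha>\<close>-closure (\<open>indicator_in_L_closure_trig_polys\<close>).
  Simple functions are dense in \<open>L\<^sup>\<alpha>(\<mu>)\<close>, and the theorem follows.\<close>


section \<open>The algebra of trigonometric polynomials\<close>

text \<open>Allowing arbitrary finite index sets gives sums and products of \<open>H\<close>-polynomials the natural
  index sets \<open>I <+> J\<close> and \<open>I \<times> J\<close>.\<close>

lemma trig_polysI:
  assumes I: "finite I" and y: "\<And>i. i \<in> I \<Longrightarrow> y i \<in> H"
  shows "(\<lambda>\<gamma>. \<Sum>i\<in>I. a i * pairing \<gamma> (y i)) \<in> trig_polys H"
proof -
  obtain h where h: "bij_betw h {0..<card I} I"
    using ex_bij_betw_nat_finite[OF I] by blast
  have "(\<Sum>i\<in>I. a i * pairing \<gamma> (y i)) = (\<Sum>k<card I. a (h k) * pairing \<gamma> (y (h k)))" for \<gamma>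
    using sum.reindex_bij_betw[OF h, of "\<lambda>i. a i * pairing \<gamma> (y i)"]
    by (simp add: atLeast0LessThan)
  moreover have "\<forall>k<card I. y (h k) \<in> H"
    using bij_betwE[OF h] y by simp
  ultimately show ?thesis
    unfolding trig_polys_def
    by (auto intro!: exI[of _ "card I"] exI[of _ "\<lambda>k. a (h k)"] exI[of _ "\<lambda>k. y (h k)"])
qed

lemma trig_polysE:
  assumes "p \<in> trig_polys H"
  obtains n :: nat and a y where "\<And>k. k < n \<Longrightarrow> y k \<in> H"
    and "p = (\<lambda>\<gamma>. \<Sum>k<n. a k * pairing \<gamma> (y k))"
  using assms unfolding trig_polys_def by blast

lemma pairing_neq_zero [simp]: "pairing \<gamma> x \<noteq> 0"
  by (metis norm_pairing norm_zero zero_neq_one)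

lemma pairing_zero_right [simp]: "pairing \<gamma> 0 = 1"
  using pairing_add_right[of \<gamma> 0 0] by simp

lemma pairing_uminus_right: "pairing \<gamma> (- x) = cnj (pairing \<gamma> x)"
proof -
  have "pairing \<gamma> x * pairing \<gamma> (- x) = 1"
    by (simp flip: pairing_add_right)
  moreover have "pairing \<gamma> x * cnj (pairing \<gamma> x) = 1"
    using complex_norm_square[of "pairing \<gamma> x"] by simp
  ultimately show ?thesis
    by (metis mult_left_cancel pairing_neq_zero)
qed

lemma pairing_diff: "pairing (\<gamma> - \<delta>) x = pairing \<gamma> x / pairing \<delta> x"
  using pairing_add[of "\<gamma> - \<delta>" \<delta> x] by simp

lemma trig_polys_add:
  assumes "p \<in> trig_polys H" "q \<in> trig_polys H"
  shows "(\<lambda>\<gamma>. p \<gamma> + q \<gamma>) \<in> trig_polys H"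
proof -
  obtain n :: nat and a y where p: "\<And>k. k < n \<Longrightarrow> y k \<in> H"
      "p = (\<lambda>\<gamma>. \<Sum>k<n. a k * pairing \<gamma> (y k))"
    using assms(1) by (rule trig_polysE) blast
  obtain m :: nat and b z where q: "\<And>k. k < m \<Longrightarrow> z k \<in> H"
      "q = (\<lambda>\<gamma>. \<Sum>k<m. b k * pairing \<gamma> (z k))"
    using assms(2) by (rule trig_polysE) blast
  have "(\<lambda>\<gamma>. \<Sum>i\<in>{..<n} <+> {..<m}. case_sum a b i * pairing \<gamma> (case_sum y z i)) \<in> trig_polys H"
    by (rule trig_polysI) (auto simp: p q)
  then show ?thesis by (simp add: sum.Plus p q)
qed

lemma trig_polys_mult:
  assumes H: "is_subgroup H" and "p \<in> trig_polys H" "q \<in> trig_polys H"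
  shows "(\<lambda>\<gamma>. p \<gamma> * q \<gamma>) \<in> trig_polys H"
proof -
  obtain n :: nat and a y where p: "\<And>k. k < n \<Longrightarrow> y k \<in> H"
      "p = (\<lambda>\<gamma>. \<Sum>k<n. a k * pairing \<gamma> (y k))"
    using assms(2) by (rule trig_polysE) blast
  obtain m :: nat and b z where q: "\<And>k. k < m \<Longrightarrow> z k \<in> H"
      "q = (\<lambda>\<gamma>. \<Sum>k<m. b k * pairing \<gamma> (z k))"
    using assms(3) by (rule trig_polysE) blast
  have "(\<lambda>\<gamma>. \<Sum>i\<in>{..<n} \<times> {..<m}. (a (fst i) * b (snd i)) * pairing \<gamma> (y (fst i) + z (snd i)))
      \<in> trig_polys H"
    using H by (intro trig_polysI) (auto simp: p q is_subgroup_def)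
  also have "(\<lambda>\<gamma>. \<Sum>i\<in>{..<n} \<times> {..<m}. (a (fst i) * b (snd i)) * pairing \<gamma> (y (fst i) + z (snd i)))
      = (\<lambda>\<gamma>. p \<gamma> * q \<gamma>)"
    by (simp add: p q sum_product sum.cartesian_product pairing_add_right split_beta mult_ac)
  finally show ?thesis .
qed

lemma trig_polys_cnj:
  assumes H: "is_subgroup H" and "p \<in> trig_polys H"
  shows "(\<lambda>\<gamma>. cnj (p \<gamma>)) \<in> trig_polys H"
proof -
  obtain n :: nat and a y where p: "\<And>k. k < n \<Longrightarrow> y k \<in> H"
      "p = (\<lambda>\<gamma>. \<Sum>k<n. a k * pairing \<gamma> (y k))"
    using assms(2) by (rule trig_polysE) blast
  have "(\<lambda>\<gamma>. \<Sum>k<n. cnj (a k) * pairing \<gamma> (- y k)) \<in> trig_polys H"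
    using H by (intro trig_polysI) (auto simp: p is_subgroup_def)
  then show ?thesis by (simp add: p pairing_uminus_right)
qed

lemma trig_polys_character: "y \<in> H \<Longrightarrow> (\<lambda>\<gamma>. pairing \<gamma> y) \<in> trig_polys H"
  using trig_polysI[of "{()}" "\<lambda>_. y" H "\<lambda>_. 1"] by simp

lemma trig_polys_const: "is_subgroup H \<Longrightarrow> (\<lambda>_. c) \<in> trig_polys H"
  using trig_polysI[of "{()}" "\<lambda>_. 0" H "\<lambda>_. c"] by (simp add: is_subgroup_def)

lemma trig_polys_continuous:
  assumes "p \<in> trig_polys H"
  shows "continuous_on UNIV p"
  using assms by (rule trig_polysE) (simp, intro continuous_intros continuous_on_pairing_left)

lemma trig_polys_bounded:
  assumes "p \<in> trig_polys H"
  obtains B where "B \<ge> 0" "\<forall>\<gamma>. norm (p \<gamma>) \<le> B"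
proof -
  obtain n :: nat and a y where p: "p = (\<lambda>\<gamma>. \<Sum>k<n. a k * pairing \<gamma> (y k))"
    using assms by (rule trig_polysE) blast
  have "norm (p \<gamma>) \<le> (\<Sum>k<n. norm (a k))" for \<gamma>
    unfolding p by (rule order_trans[OF norm_sum]) (simp add: norm_mult)
  then show thesis by (intro that[of "\<Sum>k<n. norm (a k)"]) (auto intro: sum_nonneg)
qed

text \<open>The Stone-Weierstrass theorem concerns algebras of real functions, so the real-valued
  \<open>H\<close>-polynomials are treated as functions into the reals.\<close>

definition real_trig_polys ::
    "'g :: topological_ab_group_add set \<Rightarrow> ('g dual \<Rightarrow> real) set" where
  "real_trig_polys H = {f. (\<lambda>\<gamma>. complex_of_real (f \<gamma>)) \<in> trig_polys H}"

lemma real_trig_polys_add: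
  assumes "f \<in> real_trig_polys H" "g \<in> real_trig_polys H"
  shows "(\<lambda>\<gamma>. f \<gamma> + g \<gamma>) \<in> real_trig_polys H"
  using trig_polys_add[of "\<lambda>\<gamma>. complex_of_real (f \<gamma>)" H "\<lambda>\<gamma>. complex_of_real (g \<gamma>)"] assms
  by (simp add: real_trig_polys_def)

lemma real_trig_polys_mult:
  assumes "is_subgroup H" "f \<in> real_trig_polys H" "g \<in> real_trig_polys H"
  shows "(\<lambda>\<gamma>. f \<gamma> * g \<gamma>) \<in> real_trig_polys H"
  using trig_polys_mult[of H "\<lambda>\<gamma>. complex_of_real (f \<gamma>)" "\<lambda>\<gamma>. complex_of_real (g \<gamma>)"] assms
  by (simp add: real_trig_polys_def)

lemma real_trig_polys_const: "is_subgroup H \<Longrightarrow> (\<lambda>_. c) \<in> real_trig_polys H"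
  using trig_polys_const[of H "complex_of_real c"] by (simp add: real_trig_polys_def)

lemma real_trig_polys_continuous:
  assumes "f \<in> real_trig_polys H"
  shows "continuous_on UNIV f"
proof -
  have "continuous_on UNIV (\<lambda>\<gamma>. Re (complex_of_real (f \<gamma>)))"
    using assms by (intro continuous_on_Re trig_polys_continuous) (simp add: real_trig_polys_def)
  then show ?thesis by simp
qed

text \<open>Closure under conjugation makes the real algebra as rich as the complex one.\<close>

lemma real_trig_polys_Re:
  assumes "is_subgroup H" "p \<in> trig_polys H"
  shows "(\<lambda>\<gamma>. Re (p \<gamma>)) \<in> real_trig_polys H"
proof -
  have "(\<lambda>\<gamma>. (1/2) * (p \<gamma> + cnj (p \<gamma>))) \<in> trig_polys H"
    using trig_polys_mult[OF assms(1) trig_polys_const[OF assms(1)]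
      trig_polys_add[OF assms(2) trig_polys_cnj[OF assms]]] .
  then show ?thesis by (simp add: real_trig_polys_def complex_add_cnj)
qed

lemma real_trig_polys_Im:
  assumes "is_subgroup H" "p \<in> trig_polys H"
  shows "(\<lambda>\<gamma>. Im (p \<gamma>)) \<in> real_trig_polys H"
  using real_trig_polys_Re[OF assms(1)
    trig_polys_mult[OF assms(1) trig_polys_const[OF assms(1), of "- \<i>"] assms(2)]] by simp

lemma real_trig_polys_polynomial:
  fixes q :: "real \<Rightarrow> real"
  assumes "real_polynomial_function q" and H: "is_subgroup H" and f: "f \<in> real_trig_polys H"
  shows "(\<lambda>\<gamma>. q (f \<gamma>)) \<in> real_trig_polys H"
  using assms(1)
proof induction
  case (linear l)
  then obtain c where "l = (\<lambda>x. x * c)"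
    using real_bounded_linear by blast
  then show ?case
    using real_trig_polys_mult[OF H f real_trig_polys_const[OF H, of c]] by simp
next
  case (const c)
  show ?case by (rule real_trig_polys_const[OF H])
next
  case (add q r)
  show ?case by (rule real_trig_polys_add[OF add.IH])
next
  case (mult q r)
  show ?case by (rule real_trig_polys_mult[OF H mult.IH])
qed


section \<open>Separation on a transversal\<close>

text \<open>Two characters that agree on \<open>H\<close> differ by an element of the annihilator, and translates of \<open>D\<close>
  by non-zero elements of the annihilator miss \<open>D\<close>.\<close>

lemma transversal_separated:
  assumes D: "\<forall>\<kappa>\<in>annihilator H - {0}. D \<inter> (+) \<kappa> ` D = {}"
    and "\<gamma> \<in> D" "\<delta> \<in> D" "\<gamma> \<noteq> \<delta>"
  shows "\<exists>y\<in>H. pairing \<gamma> y \<noteq> pairing \<delta> y"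
proof (rule ccontr)
  assume "\<not> ?thesis"
  then have "\<gamma> - \<delta> \<in> annihilator H"
    by (auto simp: annihilator_def pairing_diff)
  moreover have "\<gamma> - \<delta> \<noteq> 0" using \<open>\<gamma> \<noteq> \<delta>\<close> by simp
  ultimately have "D \<inter> (+) (\<gamma> - \<delta>) ` D = {}" using D by blast
  moreover have "\<gamma> \<in> (+) (\<gamma> - \<delta>) ` D"
    using \<open>\<delta> \<in> D\<close> by (intro image_eqI[of _ _ \<delta>]) simp_all
  ultimately show False using \<open>\<gamma> \<in> D\<close> by blast
qed

lemma real_trig_polys_separate_points:
  assumes H: "is_subgroup H"
    and D: "\<forall>\<kappa>\<in>annihilator H - {0}. D \<inter> (+) \<kappa> ` D = {}"
    and "\<gamma> \<in> D" "\<delta> \<in> D" "\<gamma> \<noteq> \<delta>"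
  shows "\<exists>f\<in>real_trig_polys H. f \<gamma> \<noteq> f \<delta>"
proof -
  obtain y where y: "y \<in> H" "pairing \<gamma> y \<noteq> pairing \<delta> y"
    using transversal_separated[OF D assms(3-5)] by blast
  then consider "Re (pairing \<gamma> y) \<noteq> Re (pairing \<delta> y)" | "Im (pairing \<gamma> y) \<noteq> Im (pairing \<delta> y)"
    using complex_eqI by blast
  then show ?thesis
  proof cases
    case 1
    with real_trig_polys_Re[OF H trig_polys_character[OF y(1)]] show ?thesis
      by (intro bexI[of _ "\<lambda>\<gamma>. Re (pairing \<gamma> y)"])
  next
    case 2
    with real_trig_polys_Im[OF H trig_polys_character[OF y(1)]] show ?thesis
      by (intro bexI[of _ "\<lambda>\<gamma>. Im (pairing \<gamma> y)"])
  qed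
qed

text \<open>A Urysohn lemma for \<open>H\<close>-polynomials. The two-sided bound on the whole dual group is what makes
  \<open>g\<close> useful in \<open>L\<^sup>\<alpha>\<close>; a rough separation with error \<open>1/4\<close> is enough to start with, because the
  composition with a polynomial afterwards sharpens the values on \<open>A\<close> and \<open>B\<close> and enforces the
  bound at the same time.\<close>

lemma real_trig_polys_separate_compacts:
  assumes H: "is_subgroup H"
    and D: "\<forall>\<kappa>\<in>annihilator H - {0}. D \<inter> (+) \<kappa> ` D = {}"
    and A: "compact A" "A \<subseteq> D" and B: "compact B" "B \<subseteq> D" and AB: "A \<inter> B = {}"
    and \<delta>: "0 < \<delta>"
  obtains g where "g \<in> real_trig_polys H"
    "\<forall>\<gamma>\<in>A. \<bar>g \<gamma> - 1\<bar> < \<delta>" "\<forall>\<gamma>\<in>B. \<bar>g \<gamma>\<bar> < \<delta>"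
    "\<forall>\<gamma>. - \<delta> < g \<gamma> \<and> g \<gamma> < 1 + \<delta>"
proof -
  let ?h = "\<lambda>\<gamma>. if \<gamma> \<in> A then 1 else (0::real)"
  have cont: "continuous_on (A \<union> B) ?h"
    using A B AB by (intro continuous_on_If compact_imp_closed continuous_intros) auto
  have "\<exists>f. f \<in> real_trig_polys H \<and> (\<forall>\<gamma>\<in>A \<union> B. \<bar>?h \<gamma> - f \<gamma>\<bar> < 1/4)"
  proof (rule Stone_Weierstrass_HOL[where P = "\<lambda>f. f \<in> real_trig_polys H"])
    show "compact (A \<union> B)" using A(1) B(1) by (rule compact_Un)
    show "continuous_on (A \<union> B) f" if "f \<in> real_trig_polys H" for f
      using real_trig_polys_continuous[OF that] continuous_on_subset by blast
    show "\<exists>f. f \<in> real_trig_polys H \<and> f \<gamma> \<noteq> f \<gamma>'" if "\<gamma> \<in> A \<union> B \<and> \<gamma>' \<in> A \<union> B \<and> \<gamma> \<noteq> \<gamma>'" for \<gamma> \<gamma>'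
    proof -
      have "\<gamma> \<in> D" "\<gamma>' \<in> D" "\<gamma> \<noteq> \<gamma>'" using that A B by auto
      from real_trig_polys_separate_points[OF H D this] show ?thesis by blast
    qed
    show "(\<lambda>\<gamma>. f \<gamma> + g \<gamma>) \<in> real_trig_polys H"
      if "f \<in> real_trig_polys H \<and> g \<in> real_trig_polys H" for f g
      using that real_trig_polys_add by blast
    show "(\<lambda>\<gamma>. f \<gamma> * g \<gamma>) \<in> real_trig_polys H"
      if "f \<in> real_trig_polys H \<and> g \<in> real_trig_polys H" for f g
      using that real_trig_polys_mult[OF H] by blast
    show "(\<lambda>\<gamma>. c) \<in> real_trig_polys H" for c
      by (rule real_trig_polys_const[OF H])
  qed (use cont in simp_all)
  then obtain f where f: "f \<in> real_trig_polys H"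
    and fh: "\<And>\<gamma>. \<gamma> \<in> A \<union> B \<Longrightarrow> \<bar>?h \<gamma> - f \<gamma>\<bar> < 1/4"
    by blast
  obtain M where M: "\<And>\<gamma>. \<bar>f \<gamma>\<bar> \<le> M"
    using f trig_polys_bounded unfolding real_trig_polys_def by (metis mem_Collect_eq norm_of_real)
  \<comment> \<open>The slope is chosen such that \<open>\<phi>\<close> vanishes for \<open>t \<le> 1/4\<close> and equals \<open>1\<close> for \<open>t \<ge> 3/4\<close>.\<close>
  define \<phi> :: "real \<Rightarrow> real" where "\<phi> t = max 0 (min 1 (2 * t - 1/2))" for t
  have "continuous_on {-M..M} \<phi>"
    unfolding \<phi>_def by (intro continuous_intros)
  then obtain q where q: "real_polynomial_function q" "\<And>t. t \<in> {-M..M} \<Longrightarrow> \<bar>\<phi> t - q t\<bar> < \<delta>"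
    using Stone_Weierstrass_real_polynomial_function[OF compact_Icc _ \<delta>] by metis
  have near: "\<bar>\<phi> (f \<gamma>) - q (f \<gamma>)\<bar> < \<delta>" for \<gamma>
    using M[of \<gamma>] by (intro q) (simp add: abs_le_iff)
  show thesis
  proof (rule that)
    show "(\<lambda>\<gamma>. q (f \<gamma>)) \<in> real_trig_polys H"
      by (rule real_trig_polys_polynomial[OF q(1) H f])
    show "\<forall>\<gamma>\<in>A. \<bar>q (f \<gamma>) - 1\<bar> < \<delta>"
    proof
      fix \<gamma> assume \<gamma>: "\<gamma> \<in> A"
      have "f \<gamma> > 3/4" using fh[of \<gamma>] \<gamma> unfolding abs_less_iff by simp
      then have "\<phi> (f \<gamma>) = 1" by (simp add: \<phi>_def)
      then show "\<bar>q (f \<gamma>) - 1\<bar> < \<delta>" using near[of \<gamma>] by (simp add: abs_minus_commute)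
    qed
    show "\<forall>\<gamma>\<in>B. \<bar>q (f \<gamma>)\<bar> < \<delta>"
    proof
      fix \<gamma> assume \<gamma>: "\<gamma> \<in> B"
      have "\<gamma> \<notin> A" using \<gamma> AB by blast
      then have "f \<gamma> < 1/4" using fh[of \<gamma>] \<gamma> unfolding abs_less_iff by simp
      then have "\<phi> (f \<gamma>) = 0" by (simp add: \<phi>_def)
      then show "\<bar>q (f \<gamma>)\<bar> < \<delta>" using near[of \<gamma>] by simp
    qed
    show "\<forall>\<gamma>. - \<delta> < q (f \<gamma>) \<and> q (f \<gamma>) < 1 + \<delta>"
    proof
      fix \<gamma>
      have "0 \<le> \<phi> (f \<gamma>)" "\<phi> (f \<gamma>) \<le> 1" by (auto simp: \<phi>_def)
      then show "- \<delta> < q (f \<gamma>) \<and> q (f \<gamma>) < 1 + \<delta>" using near[of \<gamma>] by (auto split: abs_split)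
    qed
  qed
qed


section \<open>Closures in \<open>L\<^sup>\<alpha>\<close>\<close>

text \<open>For \<open>\<alpha> < 1\<close> the integral of \<open>\<bar>f - g\<bar>\<^sup>\<alpha>\<close> is not a power of a norm. Measuring distance by this
  integral and using the quasi-triangle inequality with the factor \<open>2\<^sup>\<alpha>\<close> below handles all
  \<open>\<alpha> > 0\<close> uniformly.\<close>

definition L_closure :: "real \<Rightarrow> 'x measure \<Rightarrow> ('x \<Rightarrow> complex) set \<Rightarrow> ('x \<Rightarrow> complex) set" where
  "L_closure \<alpha> M P = {f \<in> borel_measurable M.
     \<forall>\<epsilon>>0. \<exists>p\<in>P. (\<integral>\<^sup>+x. ennreal (norm (p x - f x) powr \<alpha>) \<partial>M) < ennreal \<epsilon>}"

lemma norm_add_powr_le: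
  fixes a b :: "'a :: real_normed_vector"
  assumes "0 < \<alpha>"
  shows "norm (a + b) powr \<alpha> \<le> 2 powr \<alpha> * (norm a powr \<alpha> + norm b powr \<alpha>)"
proof -
  have "norm (a + b) \<le> 2 * max (norm a) (norm b)"
    using norm_triangle_ineq[of a b] by linarith
  then have "norm (a + b) powr \<alpha> \<le> (2 * max (norm a) (norm b)) powr \<alpha>"
    using assms by (intro powr_mono2) auto
  also have "\<dots> = 2 powr \<alpha> * max (norm a) (norm b) powr \<alpha>"
    by (simp add: powr_mult)
  also have "\<dots> \<le> 2 powr \<alpha> * (norm a powr \<alpha> + norm b powr \<alpha>)"
    by (intro mult_left_mono) (auto simp: max_def)
  finally show ?thesis .
qed

lemma nn_integral_powr_add_le:
  fixes f g :: "'x \<Rightarrow> complex"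
  assumes [measurable]: "f \<in> borel_measurable M" "g \<in> borel_measurable M" and \<alpha>: "0 < \<alpha>"
  shows "(\<integral>\<^sup>+x. ennreal (norm (f x + g x) powr \<alpha>) \<partial>M) \<le> ennreal (2 powr \<alpha>) *
    ((\<integral>\<^sup>+x. ennreal (norm (f x) powr \<alpha>) \<partial>M) + (\<integral>\<^sup>+x. ennreal (norm (g x) powr \<alpha>) \<partial>M))"
proof -
  have "(\<integral>\<^sup>+x. ennreal (norm (f x + g x) powr \<alpha>) \<partial>M) \<le>
      (\<integral>\<^sup>+x. ennreal (2 powr \<alpha>) * (ennreal (norm (f x) powr \<alpha>) + ennreal (norm (g x) powr \<alpha>)) \<partial>M)"
    by (intro nn_integral_mono)
      (simp flip: ennreal_plus ennreal_mult add: norm_add_powr_le[OF \<alpha>])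
  also have "\<dots> = ennreal (2 powr \<alpha>) *
    ((\<integral>\<^sup>+x. ennreal (norm (f x) powr \<alpha>) \<partial>M) + (\<integral>\<^sup>+x. ennreal (norm (g x) powr \<alpha>) \<partial>M))"
    by (simp add: nn_integral_cmult nn_integral_add)
  finally show ?thesis .
qed

text \<open>The choice of tolerance that absorbs the factor of the quasi-triangle inequality.\<close>

lemma ennreal_powr_sum_less:
  assumes "x < ennreal (\<epsilon> / (2 * 2 powr \<alpha>))" "y < ennreal (\<epsilon> / (2 * 2 powr \<alpha>))" and \<epsilon>: "0 < \<epsilon>"
  shows "ennreal (2 powr \<alpha>) * (x + y) < ennreal \<epsilon>"
proof -
  have "ennreal (2 powr \<alpha>) * (x + y) < ennreal (2 powr \<alpha>) * (ennreal (\<epsilon> / (2 * 2 powr \<alpha>)) + ennreal (\<epsilon> / (2 * 2 powr \<alpha>)))"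
    using assms by (intro ennreal_mult_strict_left_mono add_strict_mono) auto
  also have "\<dots> = ennreal \<epsilon>"
    using \<epsilon> by (simp flip: ennreal_plus ennreal_mult add: field_simps)
  finally show ?thesis .
qed

lemma L_closure_closed:
  assumes \<alpha>: "0 < \<alpha>" and P: "P \<subseteq> borel_measurable M" and f: "f \<in> borel_measurable M"
    and approx: "\<And>\<epsilon>. \<epsilon> > 0 \<Longrightarrow>
      \<exists>g\<in>L_closure \<alpha> M P. (\<integral>\<^sup>+x. ennreal (norm (g x - f x) powr \<alpha>) \<partial>M) < ennreal \<epsilon>"
  shows "f \<in> L_closure \<alpha> M P"
  unfolding L_closure_def
proof (intro CollectI conjI f allI impI)
  fix \<epsilon> :: real assume \<epsilon>: "\<epsilon> > 0"
  let ?\<epsilon> = "\<epsilon> / (2 * 2 powr \<alpha>)"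
  have \<epsilon>': "?\<epsilon> > 0" using \<epsilon> by simp
  obtain g where g: "g \<in> L_closure \<alpha> M P" "(\<integral>\<^sup>+x. ennreal (norm (g x - f x) powr \<alpha>) \<partial>M) < ennreal ?\<epsilon>"
    using approx[OF \<epsilon>'] by blast
  obtain p where p: "p \<in> P" "(\<integral>\<^sup>+x. ennreal (norm (p x - g x) powr \<alpha>) \<partial>M) < ennreal ?\<epsilon>"
    using g(1) \<epsilon>' unfolding L_closure_def by blast
  have [measurable]: "p \<in> borel_measurable M" "g \<in> borel_measurable M" "f \<in> borel_measurable M"
    using p(1) P g(1) f by (auto simp: L_closure_def)
  have "(\<integral>\<^sup>+x. ennreal (norm (p x - f x) powr \<alpha>) \<partial>M) \<le> ennreal (2 powr \<alpha>) *
    ((\<integral>\<^sup>+x. ennreal (norm (p x - g x) powr \<alpha>) \<partial>M) + (\<integral>\<^sup>+x. ennreal (norm (g x - f x) powr \<alpha>) \<partial>M))"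
    using nn_integral_powr_add_le[of "\<lambda>x. p x - g x" M "\<lambda>x. g x - f x" \<alpha>] \<alpha> by simp
  also have "\<dots> < ennreal \<epsilon>"
    by (rule ennreal_powr_sum_less[OF p(2) g(2) \<epsilon>])
  finally show "\<exists>p\<in>P. (\<integral>\<^sup>+x. ennreal (norm (p x - f x) powr \<alpha>) \<partial>M) < ennreal \<epsilon>"
    using p(1) by blast
qed

lemma L_closure_add:
  assumes \<alpha>: "0 < \<alpha>" and P: "P \<subseteq> borel_measurable M"
    and P_add: "\<And>p q. p \<in> P \<Longrightarrow> q \<in> P \<Longrightarrow> (\<lambda>x. p x + q x) \<in> P"
    and f: "f \<in> L_closure \<alpha> M P" and g: "g \<in> L_closure \<alpha> M P"
  shows "(\<lambda>x. f x + g x) \<in> L_closure \<alpha> M P"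
proof -
  have fg [measurable]: "f \<in> borel_measurable M" "g \<in> borel_measurable M"
    using f g by (auto simp: L_closure_def)
  have "\<exists>r\<in>P. (\<integral>\<^sup>+x. ennreal (norm (r x - (f x + g x)) powr \<alpha>) \<partial>M) < ennreal \<epsilon>" if \<epsilon>: "\<epsilon> > 0" for \<epsilon>
  proof -
    let ?\<epsilon> = "\<epsilon> / (2 * 2 powr \<alpha>)"
    have \<epsilon>': "?\<epsilon> > 0" using \<epsilon> by simp
    obtain p where p: "p \<in> P" "(\<integral>\<^sup>+x. ennreal (norm (p x - f x) powr \<alpha>) \<partial>M) < ennreal ?\<epsilon>"
      using f \<epsilon>' unfolding L_closure_def by blast
    obtain q where q: "q \<in> P" "(\<integral>\<^sup>+x. ennreal (norm (q x - g x) powr \<alpha>) \<partial>M) < ennreal ?\<epsilon>"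
      using g \<epsilon>' unfolding L_closure_def by blast
    have [measurable]: "p \<in> borel_measurable M" "q \<in> borel_measurable M"
      using p(1) q(1) P by auto
    have "(\<integral>\<^sup>+x. ennreal (norm (p x + q x - (f x + g x)) powr \<alpha>) \<partial>M) \<le> ennreal (2 powr \<alpha>) *
      ((\<integral>\<^sup>+x. ennreal (norm (p x - f x) powr \<alpha>) \<partial>M) + (\<integral>\<^sup>+x. ennreal (norm (q x - g x) powr \<alpha>) \<partial>M))"
      using nn_integral_powr_add_le[of "\<lambda>x. p x - f x" M "\<lambda>x. q x - g x" \<alpha>] \<alpha>
      by (simp add: algebra_simps)
    also have "\<dots> < ennreal \<epsilon>"
      by (rule ennreal_powr_sum_less[OF p(2) q(2) \<epsilon>])
    finally show ?thesis
      using P_add[OF p(1) q(1)] by (intro bexI[of _ "\<lambda>x. p x + q x"])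
  qed
  then show ?thesis by (simp add: L_closure_def)
qed

lemma L_closure_scale:
  assumes P: "P \<subseteq> borel_measurable M"
    and P_scale: "\<And>p. p \<in> P \<Longrightarrow> (\<lambda>x. c * p x) \<in> P"
    and f: "f \<in> L_closure \<alpha> M P"
  shows "(\<lambda>x. c * f x) \<in> L_closure \<alpha> M P"
proof -
  have [measurable]: "f \<in> borel_measurable M"
    using f by (auto simp: L_closure_def)
  have "\<exists>r\<in>P. (\<integral>\<^sup>+x. ennreal (norm (r x - c * f x) powr \<alpha>) \<partial>M) < ennreal \<epsilon>" if \<epsilon>: "\<epsilon> > 0" for \<epsilon>
  proof -
    let ?k = "norm c powr \<alpha>"
    have k: "?k \<ge> 0" by simp
    have "\<epsilon> / (?k + 1) > 0" using \<epsilon> k by (intro divide_pos_pos) linarith+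
    then obtain p where p: "p \<in> P"
        "(\<integral>\<^sup>+x. ennreal (norm (p x - f x) powr \<alpha>) \<partial>M) < ennreal (\<epsilon> / (?k + 1))"
      using f unfolding L_closure_def by blast
    have [measurable]: "p \<in> borel_measurable M" using p(1) P by auto
    have "norm (c * p x - c * f x) powr \<alpha> = ?k * norm (p x - f x) powr \<alpha>" for x
      by (simp add: norm_mult powr_mult flip: right_diff_distrib)
    then have "(\<integral>\<^sup>+x. ennreal (norm (c * p x - c * f x) powr \<alpha>) \<partial>M)
        = ennreal ?k * (\<integral>\<^sup>+x. ennreal (norm (p x - f x) powr \<alpha>) \<partial>M)"
      by (simp add: ennreal_mult nn_integral_cmult)
    also have "\<dots> \<le> ennreal ?k * ennreal (\<epsilon> / (?k + 1))"
      using p(2) by (intro mult_left_mono) auto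
    also have "\<dots> < ennreal \<epsilon>"
    proof -
      have "?k * (\<epsilon> / (?k + 1)) < \<epsilon>"
        using \<epsilon> k by (simp add: pos_divide_less_eq add_nonneg_pos distrib_left)
      then show ?thesis using \<epsilon> by (simp add: ennreal_less_iff flip: ennreal_mult)
    qed
    finally show ?thesis
      using P_scale[OF p(1)] by (intro bexI[of _ "\<lambda>x. c * p x"])
  qed
  then show ?thesis by (simp add: L_closure_def)
qed

text \<open>A measurable \<open>f\<close> is the pointwise limit of simple functions bounded by \<open>2\<bar>f\<bar>\<close>. The errors are then
  at most \<open>3\<bar>f\<bar>\<close>, and dominated convergence applies.\<close>

lemma simple_functions_dense:
  assumes \<alpha>: "0 < \<alpha>" and f: "f \<in> L_space \<alpha> M" and \<epsilon>: "0 < \<epsilon>"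
  obtains s where "simple_function M s"
    "(\<integral>\<^sup>+x. ennreal (norm (s x - f x) powr \<alpha>) \<partial>M) < ennreal \<epsilon>"
proof -
  have [measurable]: "f \<in> borel_measurable M"
    and fin: "(\<integral>\<^sup>+x. ennreal (norm (f x) powr \<alpha>) \<partial>M) < \<infinity>"
    using f by (auto simp: L_space_def)
  obtain s where s: "\<And>i::nat. simple_function M (s i)"
    and lim: "\<And>x. x \<in> space M \<Longrightarrow> (\<lambda>i. s i x) \<longlonglongrightarrow> f x"
    and bound: "\<And>i x. x \<in> space M \<Longrightarrow> norm (s i x) \<le> 2 * norm (f x)"
    using borel_measurable_implies_sequence_metric[of f M 0] by (simp, metis)
  have [measurable]: "s i \<in> borel_measurable M" for i
    using s by (rule borel_measurable_simple_function)
  have "(\<lambda>i. \<integral>\<^sup>+x. ennreal (norm (s i x - f x) powr \<alpha>) \<partial>M) \<longlonglongrightarrow> (\<integral>\<^sup>+x. 0 \<partial>M)"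
  proof (rule nn_integral_dominated_convergence)
    show "AE x in M. ennreal (norm (s i x - f x) powr \<alpha>) \<le> ennreal (3 powr \<alpha> * norm (f x) powr \<alpha>)" for i
    proof (rule AE_I2)
      fix x assume x: "x \<in> space M"
      have "norm (s i x - f x) \<le> 3 * norm (f x)"
        using bound[OF x, of i] norm_triangle_ineq4[of "s i x" "f x"] by linarith
      then have "norm (s i x - f x) powr \<alpha> \<le> (3 * norm (f x)) powr \<alpha>"
        using \<alpha> by (intro powr_mono2) auto
      then show "ennreal (norm (s i x - f x) powr \<alpha>) \<le> ennreal (3 powr \<alpha> * norm (f x) powr \<alpha>)"
        by (intro ennreal_leI) (simp add: powr_mult)
    qed
    show "(\<integral>\<^sup>+x. ennreal (3 powr \<alpha> * norm (f x) powr \<alpha>) \<partial>M) < \<infinity>"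
      using fin by (simp add: ennreal_mult nn_integral_cmult ennreal_mult_less_top)
    show "AE x in M. (\<lambda>i. ennreal (norm (s i x - f x) powr \<alpha>)) \<longlonglongrightarrow> 0"
    proof (rule AE_I2)
      fix x assume "x \<in> space M"
      then have "(\<lambda>i. norm (s i x - f x)) \<longlonglongrightarrow> 0"
        using lim LIM_zero tendsto_norm_zero by blast
      then have "(\<lambda>i. norm (s i x - f x) powr \<alpha>) \<longlonglongrightarrow> 0"
        using \<alpha> by (intro tendsto_zero_powrI[where b = \<alpha>]) auto
      then show "(\<lambda>i. ennreal (norm (s i x - f x) powr \<alpha>)) \<longlonglongrightarrow> 0"
        using tendsto_ennrealI by fastforce
    qed
  qed auto
  then have "eventually (\<lambda>i. (\<integral>\<^sup>+x. ennreal (norm (s i x - f x) powr \<alpha>) \<partial>M) < ennreal \<epsilon>) sequentially"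
    using \<epsilon> by (intro order_tendstoD) auto
  then show thesis using that s by (auto simp: eventually_sequentially)
qed

lemma L_space_subset_L_closure:
  assumes \<alpha>: "0 < \<alpha>" and P: "P \<subseteq> borel_measurable M"
    and P_add: "\<And>p q. p \<in> P \<Longrightarrow> q \<in> P \<Longrightarrow> (\<lambda>x. p x + q x) \<in> P"
    and P_scale: "\<And>p c. p \<in> P \<Longrightarrow> (\<lambda>x. c * p x) \<in> P"
    and ind: "\<And>B. B \<in> sets M \<Longrightarrow> indicator B \<in> L_closure \<alpha> M P"
  shows "L_space \<alpha> M \<subseteq> L_closure \<alpha> M P"
proof
  fix f assume f: "f \<in> L_space \<alpha> M"
  have simple: "s \<in> L_closure \<alpha> M P" if s: "simple_function M s" for s
  proof -
    have sum: "(\<lambda>x. \<Sum>y\<in>Y. y * indicator (s -` {y} \<inter> space M) x) \<in> L_closure \<alpha> M P"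
      if "finite Y" for Y
      using that
    proof induction
      case empty
      have "(\<lambda>x. 0 * indicator {} x) \<in> L_closure \<alpha> M P"
        by (rule L_closure_scale[OF P P_scale ind]) auto
      then show ?case by simp
    next
      case (insert y Y)
      have "s -` {y} \<inter> space M \<in> sets M"
        using s by (rule simple_functionD)
      then have i: "indicator (s -` {y} \<inter> space M) \<in> L_closure \<alpha> M P"
        by (rule ind)
      have yi: "(\<lambda>x. y * indicator (s -` {y} \<inter> space M) x) \<in> L_closure \<alpha> M P"
        by (rule L_closure_scale[OF P _ i]) (rule P_scale)
      have "(\<lambda>x. y * indicator (s -` {y} \<inter> space M) x
          + (\<Sum>y\<in>Y. y * indicator (s -` {y} \<inter> space M) x)) \<in> L_closure \<alpha> M P"
        by (rule L_closure_add[OF \<alpha> P _ yi insert.IH]) (rule P_add)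
      then show ?case by (simp only: sum.insert[OF insert.hyps])
    qed
    have [measurable]: "s \<in> borel_measurable M"
      using s by (rule borel_measurable_simple_function)
    have fin: "finite (s ` space M)" using s by (simp add: simple_function_def)
    show ?thesis
    proof (rule L_closure_closed[OF \<alpha> P])
      fix \<epsilon> :: real assume "\<epsilon> > 0"
      have "(\<Sum>y\<in>s ` space M. y * indicator (s -` {y} \<inter> space M) x) = s x" if "x \<in> space M" for x
      proof -
        have "(\<Sum>y\<in>s ` space M. y * indicator (s -` {y} \<inter> space M) x)
            = (\<Sum>y\<in>s ` space M. if y = s x then y else 0)"
          using that by (intro sum.cong) (auto simp: indicator_def)
        then show ?thesis using fin that by simp
      qed
      then have "(\<integral>\<^sup>+x. ennreal (norm ((\<Sum>y\<in>s ` space M. y * indicator (s -` {y} \<inter> space M) x) - s x) powr \<alpha>) \<partial>M)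
          = (\<integral>\<^sup>+x. 0 \<partial>M)"
        by (intro nn_integral_cong) simp
      with sum[OF fin] \<open>\<epsilon> > 0\<close> show "\<exists>g\<in>L_closure \<alpha> M P. (\<integral>\<^sup>+x. ennreal (norm (g x - s x) powr \<alpha>) \<partial>M) < ennreal \<epsilon>"
        by (intro bexI) auto
    qed simp
  qed
  show "f \<in> L_closure \<alpha> M P"
  proof (rule L_closure_closed[OF \<alpha> P])
    show "f \<in> borel_measurable M" using f by (simp add: L_space_def)
    show "\<exists>g\<in>L_closure \<alpha> M P. (\<integral>\<^sup>+x. ennreal (norm (g x - f x) powr \<alpha>) \<partial>M) < ennreal \<epsilon>" if "\<epsilon> > 0" for \<epsilon>
      using simple_functions_dense[OF \<alpha> f that] simple by metis
  qed
qed

lemma dense_in_L_if_L_closure: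
  assumes "P \<subseteq> L_space \<alpha> M" "L_space \<alpha> M \<subseteq> L_closure \<alpha> M P"
  shows "dense_in_L \<alpha> M P"
  unfolding dense_in_L_def
proof (intro conjI ballI)
  fix f assume "f \<in> L_space \<alpha> M"
  then have "\<forall>n. \<exists>p\<in>P. (\<integral>\<^sup>+x. ennreal (norm (p x - f x) powr \<alpha>) \<partial>M) < ennreal (1 / real (Suc n))"
    using assms(2) by (auto simp: L_closure_def)
  then obtain p where p: "\<And>n. p n \<in> P"
      "\<And>n. (\<integral>\<^sup>+x. ennreal (norm (p n x - f x) powr \<alpha>) \<partial>M) < ennreal (1 / real (Suc n))"
    by metis
  have "(\<lambda>n. \<integral>\<^sup>+x. ennreal (norm (p n x - f x) powr \<alpha>) \<partial>M) \<longlonglongrightarrow> 0"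
  proof (rule tendsto_sandwich[where f = "\<lambda>_. 0" and h = "\<lambda>n. ennreal (1 / real (Suc n))"])
    have "(\<lambda>n. ennreal (1 / real (Suc n))) \<longlonglongrightarrow> ennreal 0"
      using tendsto_ennrealI[OF LIMSEQ_inverse_real_of_nat] by (simp only: inverse_eq_divide)
    then show "(\<lambda>n. ennreal (1 / real (Suc n))) \<longlonglongrightarrow> 0"
      by (simp del: of_nat_Suc)
    show "\<forall>\<^sub>F n in sequentially. (\<integral>\<^sup>+x. ennreal (norm (p n x - f x) powr \<alpha>) \<partial>M) \<le> ennreal (1 / real (Suc n))"
      by (intro always_eventually allI less_imp_le p(2))
    show "\<forall>\<^sub>F n in sequentially. 0 \<le> (\<integral>\<^sup>+x. ennreal (norm (p n x - f x) powr \<alpha>) \<partial>M)"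
      by simp
  qed (rule tendsto_const)
  then show "\<exists>p. (\<forall>n. p n \<in> P) \<and> L_converges \<alpha> M p f"
    using p(1) unfolding L_converges_def by blast
qed fact


section \<open>Density\<close>

lemma trig_polys_subset_L_space:
  assumes "sets \<mu> = sets borel" "finite_measure \<mu>" "0 < \<alpha>"
  shows "trig_polys H \<subseteq> L_space \<alpha> \<mu>"
proof
  interpret finite_measure \<mu> by fact
  fix p assume p: "p \<in> trig_polys H"
  obtain B where B: "B \<ge> 0" "\<forall>\<gamma>. norm (p \<gamma>) \<le> B"
    by (rule trig_polys_bounded[OF p])
  have "p \<in> borel_measurable \<mu>"
    using borel_measurable_continuous_onI[OF trig_polys_continuous[OF p]]
      measurable_cong_sets[OF assms(1) refl] by blast
  moreover have "(\<integral>\<^sup>+x. ennreal (norm (p x) powr \<alpha>) \<partial>\<mu>) \<le> (\<integral>\<^sup>+x. ennreal (B powr \<alpha>) \<partial>\<mu>)"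
    using B assms(3) by (intro nn_integral_mono ennreal_leI powr_mono2) auto
  moreover have "\<dots> < \<infinity>"
    by (simp add: less_top[symmetric] ennreal_mult_eq_top_iff)
  ultimately show "p \<in> L_space \<alpha> \<mu>"
    unfolding L_space_def by auto
qed

text \<open>Inner regularity has to be applied to \<open>B \<inter> D\<close> and \<open>D - B\<close> separately: both compact sets must lie
  in \<open>D\<close>, where characters are separated, and on each of them the indicator of \<open>B\<close> is constant.\<close>

lemma compact_pair_exhausting:
  fixes \<mu> :: "'x :: t2_space measure"
  assumes reg: "regular_finite_borel_measure \<mu>"
    and D: "D \<in> sets borel" "emeasure \<mu> (UNIV - D) = 0" and B: "B \<in> sets borel" and \<eta>: "0 < \<eta>"
  obtains A C where "compact A" "A \<subseteq> B \<inter> D" "compact C" "C \<subseteq> D - B"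
    "emeasure \<mu> (UNIV - (A \<union> C)) \<le> ennreal \<eta>"
proof -
  have sets: "sets \<mu> = sets borel" and fin: "finite_measure \<mu>"
    using reg by (auto simp: regular_finite_borel_measure_def)
  interpret finite_measure \<mu> by (rule fin)
  have inner: "\<exists>C. compact C \<and> C \<subseteq> E \<and> measure \<mu> (E - C) < \<eta> / 2" if E: "E \<in> sets borel" for E
  proof -
    obtain C U where C: "compact C" "open U" "C \<subseteq> E" "E \<subseteq> U" "measure \<mu> (U - C) < \<eta> / 2"
      using reg E \<eta> unfolding regular_finite_borel_measure_def by (meson half_gt_zero)
    have "measure \<mu> (E - C) \<le> measure \<mu> (U - C)"
      using C by (intro finite_measure_mono) (auto simp: sets compact_imp_closed)
    with C show ?thesis by auto
  qed
  have "B \<inter> D \<in> sets borel" "D - B \<in> sets borel" using B D by auto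
  then obtain A C where A: "compact A" "A \<subseteq> B \<inter> D" "measure \<mu> (B \<inter> D - A) < \<eta> / 2"
    and C: "compact C" "C \<subseteq> D - B" "measure \<mu> (D - B - C) < \<eta> / 2"
    using inner by metis
  have [measurable]: "A \<in> sets \<mu>" "C \<in> sets \<mu>" "B \<in> sets \<mu>" "D \<in> sets \<mu>" "UNIV \<in> sets \<mu>"
    using A C B D by (auto simp: sets compact_imp_closed)
  have "emeasure \<mu> (UNIV - (A \<union> C)) \<le> emeasure \<mu> ((UNIV - D) \<union> ((B \<inter> D - A) \<union> (D - B - C)))"
    by (intro emeasure_mono) auto
  also have "\<dots> \<le> emeasure \<mu> (UNIV - D) + emeasure \<mu> ((B \<inter> D - A) \<union> (D - B - C))"
    by (intro emeasure_subadditive) auto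
  also have "\<dots> \<le> emeasure \<mu> (B \<inter> D - A) + emeasure \<mu> (D - B - C)"
    by (simp add: D emeasure_subadditive)
  also have "\<dots> \<le> ennreal (\<eta>/2) + ennreal (\<eta>/2)"
    using A C by (intro add_mono) (auto simp: emeasure_eq_measure intro!: ennreal_leI)
  also have "\<dots> = ennreal \<eta>"
    using \<eta> by (simp flip: ennreal_plus)
  finally show thesis using that A C by blast
qed

text \<open>For the Urysohn function \<open>g\<close> of the two compact sets, \<open>\<bar>g - 1\<^sub>B\<bar>\<^sup>\<alpha>\<close> is at most \<open>\<delta>\<^sup>\<alpha>\<close> on these sets and
  at most \<open>2\<^sup>\<alpha>\<close> on the complement of their union, whose measure is at most \<open>\<eta>\<close>. It remains to make
  \<open>\<delta>\<^sup>\<alpha> \<mu>(\<Gamma>) + 2\<^sup>\<alpha> \<eta>\<close> small.\<close>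

lemma indicator_in_L_closure_trig_polys:
  fixes H :: "'g :: topological_ab_group_add set"
  assumes H: "is_subgroup H" and reg: "regular_finite_borel_measure \<mu>" and \<alpha>: "0 < \<alpha>"
    and conc: "concentrated_on_transversal \<mu> (annihilator H)" and B: "B \<in> sets borel"
  shows "indicator B \<in> L_closure \<alpha> \<mu> (trig_polys H)"
proof -
  have sets: "sets \<mu> = sets borel" and fin: "finite_measure \<mu>"
    using reg by (auto simp: regular_finite_borel_measure_def)
  interpret finite_measure \<mu> by (rule fin)
  have space: "space \<mu> = UNIV" using sets_eq_imp_space_eq[OF sets] by simp
  obtain D where D: "D \<in> sets borel" "emeasure \<mu> (UNIV - D) = 0"
    and trans: "\<forall>\<kappa>\<in>annihilator H - {0}. D \<inter> (+) \<kappa> ` D = {}"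
    using conc unfolding concentrated_on_transversal_def by blast
  have "\<exists>p\<in>trig_polys H. (\<integral>\<^sup>+x. ennreal (norm (p x - indicator B x) powr \<alpha>) \<partial>\<mu>) < ennreal \<epsilon>"
    if \<epsilon>: "\<epsilon> > 0" for \<epsilon>
  proof -
    \<comment> \<open>\<open>t\<close> is to bound \<open>\<delta>\<^sup>\<alpha>\<close>. The denominator \<open>m + 1\<close> covers \<open>m = 0\<close> and makes \<open>t * m < \<epsilon>/2\<close> strict;
      \<open>\<eta>\<close> gives \<open>2\<^sup>\<alpha> * \<eta> = \<epsilon>/2\<close>. The cap \<open>\<delta> \<le> 1\<close> yields the bound \<open>1 + \<delta> \<le> 2\<close> off the compact sets.\<close>
    define m where "m = measure \<mu> UNIV"
    define t where "t = \<epsilon> / (2 * (m + 1))"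
    define \<delta> where "\<delta> = min 1 (t powr (1/\<alpha>))"
    define \<eta> where "\<eta> = \<epsilon> / (2 * 2 powr \<alpha>)"
    have m: "m \<ge> 0" by (simp add: m_def)
    have t: "t > 0" unfolding t_def using \<epsilon> m by simp
    have \<delta>: "0 < \<delta>" "\<delta> \<le> 1" using t by (auto simp: \<delta>_def)
    have "\<delta> powr \<alpha> \<le> (t powr (1/\<alpha>)) powr \<alpha>"
      using \<alpha> \<delta> by (intro powr_mono2) (auto simp: \<delta>_def)
    then have \<delta>t: "\<delta> powr \<alpha> \<le> t" using \<alpha> t by (simp add: powr_powr)
    have "\<eta> > 0" using \<epsilon> by (simp add: \<eta>_def)
    from compact_pair_exhausting[OF reg D B this] obtain A C where
      A: "compact A" "A \<subseteq> B \<inter> D" and C: "compact C" "C \<subseteq> D - B"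
      and AC: "emeasure \<mu> (UNIV - (A \<union> C)) \<le> ennreal \<eta>" .
    have "A \<subseteq> D" "C \<subseteq> D" "A \<inter> C = {}" using A C by auto
    note separate = real_trig_polys_separate_compacts[OF H trans A(1) this(1) C(1) this(2,3) \<delta>(1)]
    obtain g where g: "g \<in> real_trig_polys H" "\<forall>\<gamma>\<in>A. \<bar>g \<gamma> - 1\<bar> < \<delta>"
      "\<forall>\<gamma>\<in>C. \<bar>g \<gamma>\<bar> < \<delta>" "\<forall>\<gamma>. - \<delta> < g \<gamma> \<and> g \<gamma> < 1 + \<delta>"
      by (rule separate)
    let ?N = "UNIV - (A \<union> C)"
    have N: "?N \<in> sets \<mu>" 
      unfolding sets using A(1) C(1) by (intro borel_open open_Diff open_UNIV closed_Un compact_imp_closed)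
    have err: "norm (complex_of_real (g x) - indicator B x) = \<bar>g x - indicator B x\<bar>" for x
    proof -
      have eq: "complex_of_real (g x) - indicator B x = complex_of_real (g x - indicator B x)"
        by (simp add: indicator_def)
      show ?thesis by (simp only: eq norm_of_real)
    qed
    have bound: "\<bar>g x - indicator B x\<bar> powr \<alpha> \<le> t + 2 powr \<alpha> * indicator ?N x" for x
    proof (cases "x \<in> ?N")
      case True
      have "\<bar>g x - indicator B x\<bar> \<le> 2"
        using g(4)[rule_format, of x] \<delta> by (auto simp: indicator_def split: abs_split)
      then have "\<bar>g x - indicator B x\<bar> powr \<alpha> \<le> 2 powr \<alpha>"
        using \<alpha> by (intro powr_mono2) auto
      then show ?thesis using True t by simp
    next
      case False
      then have "\<bar>g x - indicator B x\<bar> \<le> \<delta>"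
        using g(2,3) A C by (auto simp: indicator_def intro: less_imp_le)
      then have "\<bar>g x - indicator B x\<bar> powr \<alpha> \<le> \<delta> powr \<alpha>"
        using \<alpha> by (intro powr_mono2) auto
      then show ?thesis using False \<delta>t by simp
    qed
    have "(\<integral>\<^sup>+x. ennreal (norm (complex_of_real (g x) - indicator B x) powr \<alpha>) \<partial>\<mu>)
        \<le> (\<integral>\<^sup>+x. (ennreal t + ennreal (2 powr \<alpha>) * indicator ?N x) \<partial>\<mu>)"
    proof (rule nn_integral_mono)
      fix x
      have "ennreal (t + 2 powr \<alpha> * indicator ?N x) = ennreal t + ennreal (2 powr \<alpha>) * indicator ?N x"
        using t by (simp add: indicator_def)
      then show "ennreal (norm (complex_of_real (g x) - indicator B x) powr \<alpha>)
          \<le> ennreal t + ennreal (2 powr \<alpha>) * indicator ?N x"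
        using ennreal_leI[OF bound[of x]] by (simp only: err)
    qed
    also have "\<dots> = ennreal t * ennreal m + ennreal (2 powr \<alpha>) * emeasure \<mu> ?N"
      using N by (simp add: nn_integral_add nn_integral_cmult_indicator space emeasure_eq_measure m_def)
    also have "\<dots> \<le> ennreal t * ennreal m + ennreal (2 powr \<alpha>) * ennreal \<eta>"
      using AC by (intro add_left_mono mult_left_mono) auto
    also have "\<dots> = ennreal (t * m + \<epsilon> / 2)"
      using t m \<epsilon> by (simp add: \<eta>_def flip: ennreal_mult ennreal_plus)
    also have "\<dots> < ennreal \<epsilon>"
    proof -
      have "t * (m + 1) = \<epsilon> / 2"
        using m by (simp add: t_def field_simps)
      then have "t * m + \<epsilon> / 2 < \<epsilon>" using t by (simp add: algebra_simps)
      then show ?thesis using \<epsilon> by (simp add: ennreal_lessI)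
    qed
    finally show ?thesis
      using g(1) by (intro bexI[of _ "\<lambda>x. complex_of_real (g x)"]) (simp_all add: real_trig_polys_def)
  qed
  moreover have "(indicator B :: _ \<Rightarrow> complex) \<in> borel_measurable \<mu>"
    using B by (intro borel_measurable_indicator) (simp add: sets)
  ultimately show ?thesis by (simp add: L_closure_def)
qed

theorem theorem3p8:
  fixes H :: "'g :: {topological_ab_group_add, t2_space} set"
    and \<mu> :: "'g dual measure"
    and \<alpha> :: real
  assumes "locally_compact_space (euclidean :: 'g topology)"
    and "is_subgroup H" and "closed H"
    and "regular_finite_borel_measure \<mu>"
    and "0 < \<alpha>"
    and "metrizable_space (top_of_set (annihilator H))"
    and "concentrated_on_transversal \<mu> (annihilator H)"
  shows "dense_in_L \<alpha> \<mu> (trig_polys H)"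
proof -
  have sets: "sets \<mu> = sets borel" and fin: "finite_measure \<mu>"
    using assms(4) by (auto simp: regular_finite_borel_measure_def)
  have sub: "trig_polys H \<subseteq> L_space \<alpha> \<mu>"
    by (rule trig_polys_subset_L_space[OF sets fin \<open>0 < \<alpha>\<close>])
  have "L_space \<alpha> \<mu> \<subseteq> L_closure \<alpha> \<mu> (trig_polys H)"
  proof (rule L_space_subset_L_closure[OF \<open>0 < \<alpha>\<close>])
    show "trig_polys H \<subseteq> borel_measurable \<mu>"
      using sub by (auto simp: L_space_def)
    show "indicator B \<in> L_closure \<alpha> \<mu> (trig_polys H)" if "B \<in> sets \<mu>" for B
      using that indicator_in_L_closure_trig_polys assms by (simp add: sets)
    show "(\<lambda>\<gamma>. p \<gamma> + q \<gamma>) \<in> trig_polys H"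
      if "p \<in> trig_polys H" "q \<in> trig_polys H" for p q
      using that by (rule trig_polys_add)
    show "(\<lambda>\<gamma>. c * p \<gamma>) \<in> trig_polys H" if "p \<in> trig_polys H" for p c
      using trig_polys_mult[OF \<open>is_subgroup H\<close> trig_polys_const[OF \<open>is_subgroup H\<close>] that] .
  qed
  with sub show ?thesis by (rule dense_in_L_if_L_closure)
qed

end
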